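(* Let $X$ be a Hausdorff locally convex topological vector space, let $K$ be a nonempty convex compact subset of $X$, let $D\subseteq K$ be a self segment-dense set in $K$, and let $\varphi:K\times K\to\mathbb{R}$ be a function satisfying: (i) for all $y\in D$, the function $x\mapsto\varphi(x,y)$ is lower semicontinuous on $K$; (ii) for all $x\in K$, the function $y\mapsto\varphi(x,y)$ is lower semicontinuous on $K\setminus D$; (iii) for all $x\in D$, the function $y\mapsto\varphi(x,y)$ is concave on $D$; (iv) for all $x\in D$, $\varphi(x,x)\le0$. Then there exists $x_0\in K$ such that $\varphi(x_0,y)\le0$ for all $y\in K$.
   Context: Self segment-dense: for $U\subseteq V\subseteq X$ with $V$ convex, $U$ is self segment-dense in $V$ if $U$ is dense in $V$ (i.e. $V\subseteq\operatorname{cl}(U)$) and for all $x,y\in U$ the set $[x,y]\cap U$ is dense in the closed segment $[x,y]=\{x+t(y-x):t\in[0,1]\}$. A function on $K$ is lower semicontinuous on $S\subseteq K$ if, as a function on $K$, it is lower semicontinuous at each point of $S$. A real function $f$ is concave on a (not necessarily convex) set $D$ if for all $x_1,\dots,x_n\in D$ and $\lambda_i\ge0$ with $\sum_{i=1}^n\lambda_i=1$ and $\sum_{i=1}^n\lambda_ix_i\in D$ one has $\sum_{i=1}^n\lambda_if(x_i)\le f\left(\sum_{i=1}^n\lambda_ix_i\right)$. *)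

theory Defs
  imports "HOL-Analysis.Analysis"
begin

class topological_real_vector = real_vector + topological_ab_group_add +
  assumes tendsto_scaleR_Pair:
    "((\<lambda>p. fst p *\<^sub>R snd p) \<longlongrightarrow> a *\<^sub>R x) (nhds (a::real) \<times>\<^sub>F nhds x)"

(* Every neighbourhood of 0 contains a convex neighbourhood of 0. The constants convex and interior
   are unavailable for the type parameter of a class specification, so they are written out;
   see convex_neighbourhood below. *)
class locally_convex_space = topological_real_vector +
  assumes convex_neighbourhood_base:
    "open U \<Longrightarrow> 0 \<in> U \<Longrightarrow>
      \<exists>C. (\<forall>x\<in>C. \<forall>y\<in>C. \<forall>u\<ge>0. \<forall>v\<ge>0. u + v = 1 \<longrightarrow> u *\<^sub>R x + v *\<^sub>R y \<in> C) \<and>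
        (\<exists>V. open V \<and> 0 \<in> V \<and> V \<subseteq> C) \<and> C \<subseteq> U"

lemma convex_neighbourhood:
  fixes U :: "'a::locally_convex_space set"
  assumes "open U" "0 \<in> U"
  shows "\<exists>C. convex C \<and> 0 \<in> interior C \<and> C \<subseteq> U"
  using convex_neighbourhood_base[OF assms] unfolding convex_def interior_def by blast

instance real_normed_vector \<subseteq> topological_ab_group_add ..

instance real_normed_vector \<subseteq> topological_real_vector
proof
  show "((\<lambda>p. fst p *\<^sub>R snd p) \<longlongrightarrow> a *\<^sub>R x) (nhds (a::real) \<times>\<^sub>F nhds x)" for a and x :: 'a
    by (intro tendsto_scaleR filterlim_fst filterlim_snd)
qed

instance real_normed_vector \<subseteq> locally_convex_space
proof
  fix U :: "'a set"
  assume "open U" "0 \<in> U"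
  then obtain e where "e > 0" "ball 0 e \<subseteq> U"
    by (meson openE)
  then show "\<exists>C. (\<forall>x\<in>C. \<forall>y\<in>C. \<forall>u\<ge>0. \<forall>v\<ge>0. u + v = 1 \<longrightarrow> u *\<^sub>R x + v *\<^sub>R y \<in> C) \<and>
      (\<exists>V. open V \<and> 0 \<in> V \<and> V \<subseteq> C) \<and> C \<subseteq> U"
    using convex_ball[of "0::'a" e] unfolding convex_def
    by (intro exI[of _ "ball 0 e"] conjI) (auto intro!: exI[of _ "ball 0 e"])
qed

definition self_segment_dense :: "'a::topological_real_vector set \<Rightarrow> 'a set \<Rightarrow> bool"
  where "self_segment_dense U V \<longleftrightarrow>
    U \<subseteq> V \<and> convex V \<and> V \<subseteq> closure U \<and>
    (\<forall>x\<in>U. \<forall>y\<in>U. closed_segment x y \<subseteq> closure (closed_segment x y \<inter> U))"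

(* f is regarded as a function on K; its values outside K are irrelevant.
   The punctured filter suffices, since the inequality is trivial at x itself. *)
definition lower_semicontinuous_at_within ::
    "'a::topological_space set \<Rightarrow> ('a \<Rightarrow> real) \<Rightarrow> 'a \<Rightarrow> bool"
  where "lower_semicontinuous_at_within K f x \<longleftrightarrow>
    (\<forall>c. c < f x \<longrightarrow> (\<forall>\<^sub>F z in at x within K. c < f z))"

(* Neighbourhoods are taken relative to K, not to S: this is stronger than lower
   semicontinuity of the restriction of f to S. *)
definition lower_semicontinuous_on ::
    "'a::topological_space set \<Rightarrow> 'a set \<Rightarrow> ('a \<Rightarrow> real) \<Rightarrow> bool"
  where "lower_semicontinuous_on K S f \<longleftrightarrow>
    (\<forall>x\<in>S. lower_semicontinuous_at_within K f x)"

(* The library's concave_on requires D to be convex. Here D is arbitrary, and the inequality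
   is imposed only on those convex combinations that fall into D. *)
definition concave_on_set :: "'a::real_vector set \<Rightarrow> ('a \<Rightarrow> real) \<Rightarrow> bool"
  where "concave_on_set D f \<longleftrightarrow>
    (\<forall>(n::nat) (x :: nat \<Rightarrow> 'a) (l :: nat \<Rightarrow> real).
      (\<forall>i\<in>{1..n}. x i \<in> D \<and> 0 \<le> l i) \<longrightarrow>
      (\<Sum>i=1..n. l i) = 1 \<longrightarrow>
      (\<Sum>i=1..n. l i *\<^sub>R x i) \<in> D \<longrightarrow>
      (\<Sum>i=1..n. l i * f (x i)) \<le> f (\<Sum>i=1..n. l i *\<^sub>R x i))"

end

theory Submission
  imports Defs
begin

text \<open>The sets \<open>{x \<in> K. \<phi> x y \<le> 0}\<close> for \<open>y \<in> D\<close> are compact, and any point in all of them is a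
  solution, since \<open>D\<close> is dense and \<open>\<phi> x\<^sub>0\<close> is lower semicontinuous off \<open>D\<close>. They intersect by the
  Knaster--Kuratowski--Mazurkiewicz theorem: concavity and \<open>\<phi> x x \<le> 0\<close> give the covering property
  only at the points of a polytope that lie in \<open>D\<close>, but self segment-density makes these points
  dense in the polytope, and finite unions of closed sets are closed. The KKM theorem is derived
  from Brouwer's theorem on cubes of arbitrary dimension, which in turn follows from Kuhn's
  combinatorial lemma.\<close>

section \<open>Brouwer's theorem on cubes of variable dimension\<close>

text \<open>The library states Brouwer's theorem for Euclidean types only, so that the dimension cannot
  depend on the context; here \<open>[0,1]\<^sup>n\<close> is realised inside the metric space \<open>nat \<Rightarrow> real\<close>.\<close>

definition nat_cube :: "nat \<Rightarrow> (nat \<Rightarrow> real) set"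
  where "nat_cube n = (\<Pi> i\<in>UNIV. if i < n then {0..1} else {0})"

lemma nat_cube_iff: "x \<in> nat_cube n \<longleftrightarrow> (\<forall>i<n. 0 \<le> x i \<and> x i \<le> 1) \<and> (\<forall>i\<ge>n. x i = 0)"
proof -
  have "x i \<in> (if i < n then {0..1} else {0}) \<longleftrightarrow> (i < n \<longrightarrow> 0 \<le> x i \<and> x i \<le> 1) \<and> (i \<ge> n \<longrightarrow> x i = 0)" for i
    by (cases "i < n") auto
  then show ?thesis
    unfolding nat_cube_def Pi_iff by blast
qed

text \<open>Tychonoff's theorem, each factor being an interval or a single point.\<close>

lemma compact_nat_cube: "compact (nat_cube n)"
proof -
  have "compactin (product_topology (\<lambda>i::nat. euclidean :: real topology) UNIV)
      (PiE UNIV (\<lambda>i. if i < n then {0..1} else {0}))"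
    by (subst compactin_PiE) auto
  then show ?thesis
    by (simp add: nat_cube_def PiE_UNIV_domain Pi_def euclidean_product_topology)
qed

lemma tendsto_nat_fun:
  fixes X :: "'b \<Rightarrow> nat \<Rightarrow> real"
  assumes "\<And>i. ((\<lambda>k. X k i) \<longlongrightarrow> x i) F"
  shows "(X \<longlongrightarrow> x) F"
proof -
  have "limitin (product_topology (\<lambda>i::nat. euclidean :: real topology) UNIV) X x F"
    using assms by (auto simp: limitin_componentwise)
  then show ?thesis
    by (simp add: euclidean_product_topology)
qed

lemma tendsto_nat_fun_component:
  fixes X :: "'b \<Rightarrow> nat \<Rightarrow> real"
  assumes "(X \<longlongrightarrow> x) F"
  shows "((\<lambda>k. X k i) \<longlongrightarrow> x i) F"
proof -
  have "isCont (\<lambda>y::nat \<Rightarrow> real. y i) x"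
    using continuous_on_product_coordinates[of i] continuous_on_eq_continuous_at[OF open_UNIV]
    by blast
  then show ?thesis
    using assms by (rule isCont_tendsto_compose)
qed

text \<open>The combinatorial half of Brouwer's theorem: Kuhn's lemma finds a cell of the grid of
  mesh \<open>1/p\<close> in which each coordinate is not lowered by \<open>f\<close> at one vertex
  and not raised at another.\<close>

lemma brouwer_grid:
  fixes f :: "(nat \<Rightarrow> real) \<Rightarrow> nat \<Rightarrow> real"
  assumes range: "\<And>x i. x \<in> nat_cube n \<Longrightarrow> i < n \<Longrightarrow> f x i \<in> {0..1}"
    and "0 < p"
  shows "\<exists>q\<in>nat_cube n. \<forall>i<n. \<exists>a\<in>nat_cube n. \<exists>b\<in>nat_cube n.
    a i \<le> f a i \<and> f b i \<le> b i \<and> (\<forall>j. \<bar>a j - q j\<bar> \<le> 1 / real p \<and> \<bar>b j - q j\<bar> \<le> 1 / real p)"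
proof -
  define g where "g z = (\<lambda>i. if i < n then real (z i) / real p else 0)" for z :: "nat \<Rightarrow> nat"
  \<comment> \<open>Label 1 is forced on the face \<open>z i = p\<close>, as Kuhn's boundary
    condition demands. It still signals that the coordinate is not raised there, because
    \<open>f\<close> is at most 1.\<close>
  define label where
    "label z i = (if g z i \<le> f (g z) i \<and> z i \<noteq> p then 0 else 1 :: nat)" for z i
  have cube: "g z \<in> nat_cube n" if "\<forall>i<n. z i \<le> p" for z
    using that \<open>0 < p\<close> by (auto simp: nat_cube_iff g_def)
  have low: "g z i \<le> f (g z) i" if "label z i = 0" for z i
    using that by (auto simp: label_def split: if_splits)
  have up: "f (g z) i \<le> g z i" if "label z i \<noteq> 0" "i < n" "\<forall>i<n. z i \<le> p" for z i
  proof (cases "z i = p")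
    case True
    then have "g z i = 1"
      using \<open>0 < p\<close> \<open>i < n\<close> by (simp add: g_def)
    then show ?thesis
      using range[OF cube[OF that(3)] \<open>i < n\<close>] by simp
  next
    case False
    then show ?thesis
      using that(1) by (auto simp: label_def split: if_splits)
  qed
  have label_01: "label z i = 0 \<or> label z i = 1" for z i
    by (simp add: label_def)
  have zero: "label z i = 0" if "\<forall>i<n. z i \<le> p" "i < n" "z i = 0" for z i
    using that range[OF cube[OF that(1)] \<open>i < n\<close>] \<open>0 < p\<close> by (auto simp: label_def g_def)
  obtain q where q: "\<forall>i<n. q i < p"
    and rs: "\<forall>i<n. \<exists>r s. (\<forall>j<n. q j \<le> r j \<and> r j \<le> q j + 1) \<and>
        (\<forall>j<n. q j \<le> s j \<and> s j \<le> q j + 1) \<and> label r i \<noteq> label s i"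
  proof (rule kuhn_lemma[of p n label])
    show "\<forall>x. (\<forall>i<n. x i \<le> p) \<longrightarrow> (\<forall>i<n. x i = 0 \<longrightarrow> label x i = 0)"
      using zero by blast
  qed (use \<open>0 < p\<close> in \<open>auto simp: label_def\<close>)
  have near: "\<bar>g r j - g q j\<bar> \<le> 1 / real p" if "\<forall>j<n. q j \<le> r j \<and> r j \<le> q j + 1" for r j
  proof (cases "j < n")
    case True
    then have "\<bar>real (r j) - real (q j)\<bar> \<le> 1"
      using that[rule_format, OF True] by linarith
    then show ?thesis
      using True \<open>0 < p\<close> by (simp add: g_def divide_right_mono flip: diff_divide_distrib)
  qed (simp add: g_def)
  have "\<exists>a\<in>nat_cube n. \<exists>b\<in>nat_cube n. a i \<le> f a i \<and> f b i \<le> b i \<and>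
      (\<forall>j. \<bar>a j - g q j\<bar> \<le> 1 / real p \<and> \<bar>b j - g q j\<bar> \<le> 1 / real p)" if "i < n" for i
  proof -
    \<comment> \<open>Kuhn's lemma only says that the two labels differ; \<open>r\<close> and
      \<open>s\<close> are exchanged if necessary so that \<open>r\<close> has label 0.\<close>
    obtain r s where r: "\<forall>j<n. q j \<le> r j \<and> r j \<le> q j + 1"
      and s: "\<forall>j<n. q j \<le> s j \<and> s j \<le> q j + 1" and l: "label r i = 0" "label s i \<noteq> 0"
      using rs[rule_format, OF \<open>i < n\<close>] label_01 by metis
    \<comment> \<open>The strict bound \<open>q j < p\<close> keeps both vertices, whose coordinates
      are at most \<open>q j + 1\<close>, inside the grid.\<close>
    have le: "\<forall>j<n. r j \<le> p" "\<forall>j<n. s j \<le> p"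
      using q r s by (fastforce dest: Suc_leI)+
    show ?thesis
      using cube[OF le(1)] cube[OF le(2)] low[OF l(1)] up[OF l(2) \<open>i < n\<close> le(2)] near[OF r] near[OF s]
      by blast
  qed
  moreover have "g q \<in> nat_cube n"
    using q by (intro cube) (simp add: less_imp_le)
  ultimately show ?thesis
    by blast
qed

text \<open>As the mesh shrinks, a subsequence of grid corners converges to some \<open>x\<close> by
  compactness. The nearby vertices converge to \<open>x\<close> too, and continuity turns the two
  grid inequalities into \<open>x i \<le> f x i\<close> and \<open>f x i \<le> x i\<close>.\<close>

lemma brouwer_nat_cube:
  fixes f :: "(nat \<Rightarrow> real) \<Rightarrow> nat \<Rightarrow> real"
  assumes cont: "\<And>i. i < n \<Longrightarrow> continuous_on (nat_cube n) (\<lambda>x. f x i)"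
    and range: "\<And>x i. x \<in> nat_cube n \<Longrightarrow> i < n \<Longrightarrow> f x i \<in> {0..1}"
  obtains x where "x \<in> nat_cube n" "\<And>i. i < n \<Longrightarrow> f x i = x i"
proof -
  have "\<exists>q\<in>nat_cube n. \<forall>i<n. \<exists>a\<in>nat_cube n. \<exists>b\<in>nat_cube n.
      a i \<le> f a i \<and> f b i \<le> b i \<and>
      (\<forall>j. \<bar>a j - q j\<bar> \<le> 1 / real (Suc k) \<and> \<bar>b j - q j\<bar> \<le> 1 / real (Suc k))" for k
    using brouwer_grid[of n f "Suc k", OF range] by blast
  then obtain q where q: "\<And>k. q k \<in> nat_cube n"
    and ab: "\<And>k i. i < n \<Longrightarrow> \<exists>a\<in>nat_cube n. \<exists>b\<in>nat_cube n. a i \<le> f a i \<and> f b i \<le> b i \<and>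
      (\<forall>j. \<bar>a j - q k j\<bar> \<le> 1 / real (Suc k) \<and> \<bar>b j - q k j\<bar> \<le> 1 / real (Suc k))"
    by metis
  obtain x r where x: "x \<in> nat_cube n" and r: "strict_mono r" and lim: "(q \<circ> r) \<longlonglongrightarrow> x"
    using compact_nat_cube[of n] q unfolding compact_def by metis
  have *: "c \<longlonglongrightarrow> x"
    if "\<And>k j. \<bar>c k j - q (r k) j\<bar> \<le> 1 / real (Suc (r k))" for c :: "nat \<Rightarrow> nat \<Rightarrow> real"
  proof (rule tendsto_nat_fun)
    fix j
    have inv: "(\<lambda>k. 1 / real (Suc (r k))) \<longlonglongrightarrow> 0"
      using LIMSEQ_subseq_LIMSEQ[OF LIMSEQ_inverse_real_of_nat r] by (simp add: o_def field_simps)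
    have "(\<lambda>k. c k j - q (r k) j) \<longlonglongrightarrow> 0"
      by (rule Lim_null_comparison[OF _ inv]) (use that in auto)
    moreover have "(\<lambda>k. q (r k) j) \<longlonglongrightarrow> x j"
      using tendsto_nat_fun_component[OF lim] by (simp add: o_def)
    ultimately have "(\<lambda>k. (c k j - q (r k) j) + q (r k) j) \<longlonglongrightarrow> 0 + x j"
      by (rule tendsto_add)
    then show "(\<lambda>k. c k j) \<longlonglongrightarrow> x j"
      by simp
  qed
  have "f x i = x i" if "i < n" for i
  proof -
    \<comment> \<open>The vertices depend on \<open>i\<close>, so their sequences are chosen after
      \<open>i\<close> is fixed; the corners \<open>q (r k)\<close> and the limit \<open>x\<close>
      are common to all coordinates.\<close>
    have "\<exists>a b. a \<in> nat_cube n \<and> b \<in> nat_cube n \<and> a i \<le> f a i \<and> f b i \<le> b i \<and>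
        (\<forall>j. \<bar>a j - q (r k) j\<bar> \<le> 1 / real (Suc (r k)) \<and>
          \<bar>b j - q (r k) j\<bar> \<le> 1 / real (Suc (r k)))" for k
      using ab[OF that, of "r k"] by blast
    then obtain a b where "\<And>k. a k \<in> nat_cube n \<and> b k \<in> nat_cube n \<and>
        a k i \<le> f (a k) i \<and> f (b k) i \<le> b k i \<and>
        (\<forall>j. \<bar>a k j - q (r k) j\<bar> \<le> 1 / real (Suc (r k)) \<and>
          \<bar>b k j - q (r k) j\<bar> \<le> 1 / real (Suc (r k)))"
      by metis
    then have a: "a k \<in> nat_cube n" "a k i \<le> f (a k) i"
      and b: "b k \<in> nat_cube n" "f (b k) i \<le> b k i"
      and near: "\<bar>a k j - q (r k) j\<bar> \<le> 1 / real (Suc (r k))"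
        "\<bar>b k j - q (r k) j\<bar> \<le> 1 / real (Suc (r k))" for k j
      by blast+
    have A: "a \<longlonglongrightarrow> x" and B: "b \<longlonglongrightarrow> x"
      using near by (auto intro: *)
    have "(\<lambda>k. f (a k) i) \<longlonglongrightarrow> f x i"
      by (rule continuous_on_tendsto_compose[OF cont[OF that] A x]) (simp add: a)
    moreover have "(\<lambda>k. f (b k) i) \<longlonglongrightarrow> f x i"
      by (rule continuous_on_tendsto_compose[OF cont[OF that] B x]) (simp add: b)
    ultimately have "x i \<le> f x i" "f x i \<le> x i"
      using tendsto_nat_fun_component[OF A, of i] tendsto_nat_fun_component[OF B, of i] a(2) b(2)
      by (auto intro: LIMSEQ_le)
    then show ?thesis
      by simp
  qed
  then show thesis
    using that x by blast
qed

section \<open>The Knaster--Kuratowski--Mazurkiewicz theorem\<close>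

lemma continuous_on_scaleR_tvs:
  fixes g :: "'b::topological_space \<Rightarrow> 'a::topological_real_vector"
  assumes "continuous_on S f" "continuous_on S g"
  shows "continuous_on S (\<lambda>x. f x *\<^sub>R g x)"
  unfolding continuous_on_def
proof
  fix x assume "x \<in> S"
  then have "LIM y at x within S. (f y, g y) :> nhds (f x) \<times>\<^sub>F nhds (g x)"
    using assms by (intro filterlim_Pair) (auto simp: continuous_on_def)
  from filterlim_compose[OF tendsto_scaleR_Pair this]
  show "((\<lambda>x. f x *\<^sub>R g x) \<longlongrightarrow> f x *\<^sub>R g x) (at x within S)"
    by simp
qed

text \<open>If the \<open>F i\<close> had no common point, weights proportional to the distances
  from their preimages would define a self-map of the simplex. At a fixed point the positive weights
  belong exactly to the \<open>F i\<close> missing its image, contrary to \<open>cover\<close>.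
  Demanding \<open>0 < w i\<close> there encodes the KKM condition on all faces at once.\<close>

lemma kkm_indexed:
  fixes z :: "nat \<Rightarrow> 'a::topological_real_vector"
  assumes closed: "\<And>i. i \<le> n \<Longrightarrow> closed (F i)"
    and cover: "\<And>w. (\<And>i. i \<le> n \<Longrightarrow> 0 \<le> w i) \<Longrightarrow> (\<Sum>i\<le>n. w i) = 1 \<Longrightarrow>
      \<exists>i\<le>n. 0 < w i \<and> (\<Sum>i\<le>n. w i *\<^sub>R z i) \<in> F i"
  shows "(\<Inter>i\<le>n. F i) \<noteq> {}"
proof (rule ccontr)
  assume empty: "\<not> (\<Inter>i\<le>n. F i) \<noteq> {}"
  \<comment> \<open>barycentric coordinates of the image under a retraction of the cube onto the corner simplex;
    the corner \<open>0\<close> is the vertex with index \<open>n\<close>\<close>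
  define s where "s x = max 1 (\<Sum>i<n. x i)" for x :: "nat \<Rightarrow> real"
  define w where "w x j = (if j < n then x j / s x else 1 - (\<Sum>i<n. x i) / s x)" for x j
  define p where "p x = (\<Sum>j\<le>n. w x j *\<^sub>R z j)" for x
  \<comment> \<open>Distances are measured in the parameter space
    \<open>nat \<Rightarrow> real\<close>, because the vector space need not be metrizable.\<close>
  define d where "d j x = infdist x (p -` F j)" for j x
  define t where "t x = (\<Sum>j\<le>n. d j x)" for x
  have sum_w: "(\<Sum>j\<le>n. w x j) = 1" for x
    by (simp add: w_def lessThan_Suc_atMost[symmetric] sum_divide_distrib)
  have s_pos: "0 < s x" for x
    by (simp add: s_def max_def)
  have cont_s: "continuous_on UNIV s"
    unfolding s_def
    by (intro continuous_on_max continuous_on_const continuous_on_sum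
        continuous_on_product_coordinates)
  have cont_w: "continuous_on UNIV (\<lambda>x. w x j)" for j
    unfolding w_def using s_pos[THEN less_imp_neq, THEN not_sym]
    by (cases "j < n") (auto intro!: continuous_on_divide continuous_on_diff continuous_on_const
        continuous_on_sum continuous_on_product_coordinates cont_s)
  have cont_p: "continuous_on UNIV p"
    unfolding p_def by (intro continuous_on_sum continuous_on_scaleR_tvs cont_w continuous_on_const)
  have closed_vimage: "closed (p -` F j)" if "j \<le> n" for j
    using closed[OF that] cont_p by (rule closed_vimage)
  \<comment> \<open>\<open>infdist\<close> to the empty set is 0 by convention, so zero distance
    means membership only once this is known. The corner \<open>e\<close> is mapped to the vertex
    \<open>z j\<close>, which \<open>cover\<close> puts into \<open>F j\<close>.\<close>
  have nonempty: "p -` F j \<noteq> {}" if "j \<le> n" for j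
  proof -
    define e where "e = (\<lambda>i. if i = j \<and> i < n then 1 else 0 :: real)"
    have "(\<Sum>i<n. e i) = (if j < n then 1 else 0)"
      by (simp add: e_def)
    then have "w e i = (if i = j then 1 else 0)" if "i \<le> n" for i
      using \<open>j \<le> n\<close> that by (auto simp: w_def s_def e_def)
    then have "p e = z j"
      using \<open>j \<le> n\<close> by (simp add: p_def if_distrib[of "\<lambda>c. c *\<^sub>R _"] cong: if_cong)
    moreover have "z j \<in> F j"
      using cover[of "\<lambda>i. if i = j then 1 else 0"] \<open>j \<le> n\<close>
      by (force simp: if_distrib[of "\<lambda>c. c *\<^sub>R _"] cong: if_cong split: if_splits)
    ultimately show ?thesis
      by auto
  qed
  have d_nonneg: "0 \<le> d j x" for j x
    by (simp add: d_def infdist_nonneg)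
  have d_pos: "0 < d j x \<longleftrightarrow> p x \<notin> F j" if "j \<le> n" for j x
    using in_closed_iff_infdist_zero[OF closed_vimage nonempty, OF that that, of x] d_nonneg[of j x]
    by (auto simp: d_def less_le)
  have t_pos: "0 < t x" for x
  proof -
    obtain j where "j \<le> n" "p x \<notin> F j"
      using empty by blast
    then show ?thesis
      unfolding t_def using d_pos d_nonneg by (intro sum_pos2[of _ j]) auto
  qed
  have d_le: "d j x \<le> t x" if "j \<le> n" for j x
    unfolding t_def using that by (intro member_le_sum) (auto simp: d_nonneg)
  have cont_d: "continuous_on S (d j)" for S j
    unfolding d_def by (intro continuous_on_infdist continuous_on_id)
  obtain x where "x \<in> nat_cube n" and fixed: "\<And>i. i < n \<Longrightarrow> d i x / t x = x i"
  proof (rule brouwer_nat_cube[of n "\<lambda>x i. d i x / t x"])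
    show "continuous_on (nat_cube n) (\<lambda>x. d i x / t x)" for i
      using t_pos unfolding t_def
      by (intro continuous_on_divide continuous_on_sum cont_d) (metis less_irrefl)
    show "d i x / t x \<in> {0..1}" if "i < n" for x i
      using that t_pos[of x] d_nonneg[of i x] d_le[of i x] by simp
  qed blast
  \<comment> \<open>At the fixed point the coordinates sum to at most 1, so the retraction does not
    move it and the weights are the normalised distances, the one with index \<open>n\<close>
    included.\<close>
  have "(\<Sum>i<n. x i) = (\<Sum>i<n. d i x) / t x"
    by (simp add: sum_divide_distrib fixed[symmetric])
  also have "(\<Sum>i<n. d i x) = t x - d n x"
    by (simp add: t_def lessThan_Suc_atMost[symmetric])
  finally have sum_x: "(\<Sum>i<n. x i) = 1 - d n x / t x"
    using t_pos[of x] by (simp add: diff_divide_distrib)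
  then have "s x = 1"
    using t_pos[of x] d_nonneg[of n x] by (simp add: s_def)
  then have w: "w x j = d j x / t x" if "j \<le> n" for j
    using that sum_x fixed[of j] by (auto simp: w_def)
  then have "\<exists>j\<le>n. 0 < w x j \<and> p x \<in> F j"
    unfolding p_def using t_pos[of x] d_nonneg by (intro cover sum_w) simp
  then show False
    using w d_pos t_pos[of x] by (auto simp: zero_less_divide_iff)
qed

text \<open>The support of a weight vector spans the face to which \<open>cover\<close> applies, so
  the index found there has positive weight.\<close>

lemma kkm:
  fixes G :: "'a::topological_real_vector \<Rightarrow> 'a set"
  assumes "finite S"
    and closed: "\<And>y. y \<in> S \<Longrightarrow> closed (G y)"
    and cover: "\<And>T. T \<subseteq> S \<Longrightarrow> convex hull T \<subseteq> (\<Union>y\<in>T. G y)"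
  shows "(\<Inter>y\<in>S. G y) \<noteq> {}"
proof (cases "S = {}")
  case False
  then obtain n where "card S = Suc n"
    using \<open>finite S\<close> by (metis card_eq_0_iff not0_implies_Suc)
  then obtain z where z: "bij_betw z {..n} S"
    using ex_bij_betw_nat_finite[OF \<open>finite S\<close>]
    by (auto simp: atLeast0LessThan lessThan_Suc_atMost)
  have "(\<Inter>i\<le>n. G (z i)) \<noteq> {}"
  proof (rule kkm_indexed[where z = z])
    show "closed (G (z i))" if "i \<le> n" for i
      using that z closed by (auto simp: bij_betw_def)
    fix w :: "nat \<Rightarrow> real"
    assume nonneg: "\<And>i. i \<le> n \<Longrightarrow> 0 \<le> w i" and sum: "(\<Sum>i\<le>n. w i) = 1"
    define I where "I = {i. i \<le> n \<and> 0 < w i}"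
    have I: "finite I" "I \<subseteq> {..n}"
      by (auto simp: I_def)
    have rest: "w i = 0" if "i \<in> {..n} - I" for i
      using that nonneg[of i] by (auto simp: I_def)
    have "(\<Sum>i\<in>I. w i) = 1"
      using sum rest I by (metis (no_types, lifting) finite_atMost sum.mono_neutral_left)
    moreover have "(\<Sum>i\<in>I. w i *\<^sub>R z i) = (\<Sum>i\<le>n. w i *\<^sub>R z i)"
      using rest I by (intro sum.mono_neutral_left) auto
    moreover have "(\<Sum>i\<in>I. w i *\<^sub>R z i) \<in> convex hull (z ` I)" if "(\<Sum>i\<in>I. w i) = 1"
      using I that nonneg by (intro convex_sum) (auto intro: hull_inc)
    ultimately have "(\<Sum>i\<le>n. w i *\<^sub>R z i) \<in> (\<Union>y\<in>z ` I. G y)"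
      using cover[of "z ` I"] z I by (auto simp: bij_betw_def)
    then show "\<exists>i\<le>n. 0 < w i \<and> (\<Sum>i\<le>n. w i *\<^sub>R z i) \<in> G (z i)"
      by (auto simp: I_def)
  qed
  then show ?thesis
    using z by (auto simp: bij_betw_def)
qed simp

section \<open>Self segment-dense sets\<close>

text \<open>A point of the larger hull lies on a segment from \<open>a\<close> to some
  \<open>b\<close> in the smaller one. Replacing \<open>b\<close> by a nearby \<open>c\<close> in
  \<open>D\<close> gives a segment with both ends in \<open>D\<close>, where the density on segments
  applies.\<close>

lemma self_segment_dense_convex_hull:
  assumes D: "self_segment_dense D V" and "finite T" "T \<subseteq> D"
  shows "convex hull T \<subseteq> closure (convex hull T \<inter> D)"
  using \<open>finite T\<close> \<open>T \<subseteq> D\<close>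
proof (induction T rule: finite_induct)
  case (insert a T)
  show ?case
  proof (cases "T = {}")
    case True
    then show ?thesis
      using insert.prems closure_subset[of "{a}"] by simp
  next
    case False
    let ?C = "closure (convex hull (insert a T) \<inter> D)"
    show ?thesis
    proof
      fix x assume "x \<in> convex hull (insert a T)"
      then obtain u v b where uv: "0 \<le> u" "0 \<le> v" "u + v = 1"
        and b: "b \<in> convex hull T" and x: "x = u *\<^sub>R a + v *\<^sub>R b"
        by (auto simp: convex_hull_insert[OF False])
      have "u *\<^sub>R a + v *\<^sub>R c \<in> ?C" if c: "c \<in> convex hull T \<inter> D" for c
      proof -
        have "u = 1 - v"
          using uv by simp
        then have "u *\<^sub>R a + v *\<^sub>R c \<in> closed_segment a c"
          using uv by (auto simp: in_segment)
        also have "\<dots> \<subseteq> closure (closed_segment a c \<inter> D)"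
          using D c insert.prems by (auto simp: self_segment_dense_def)
        also have "\<dots> \<subseteq> ?C"
        proof (intro closure_mono Int_mono subset_refl closed_segment_subset convex_convex_hull)
          show "c \<in> convex hull (insert a T)"
            using c hull_mono[of T "insert a T"] by blast
        qed (simp add: hull_inc)
        finally show ?thesis .
      qed
      \<comment> \<open>By continuity and the closedness of \<open>?C\<close>, the inclusion passes
        from the points \<open>c\<close> to their limits, among them \<open>b\<close> by the
        induction hypothesis.\<close>
      then have "(\<lambda>c. u *\<^sub>R a + v *\<^sub>R c) ` closure (convex hull T \<inter> D) \<subseteq> ?C"
        by (intro image_closure_subset continuous_on_add continuous_on_const
            continuous_on_scaleR_tvs continuous_on_id) auto
      then show "x \<in> ?C"
        using insert b x by blast
    qed
  qed
qed simp

section \<open>Concavity on sets that need not be convex\<close>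

lemma concave_on_setD:
  assumes "concave_on_set D f" "finite T" "T \<subseteq> D"
    and nonneg: "\<And>y. y \<in> T \<Longrightarrow> 0 \<le> u y" and sum: "(\<Sum>y\<in>T. u y) = 1"
    and mem: "(\<Sum>y\<in>T. u y *\<^sub>R y) \<in> D"
  shows "(\<Sum>y\<in>T. u y * f y) \<le> f (\<Sum>y\<in>T. u y *\<^sub>R y)"
proof -
  obtain z where z: "bij_betw z {1..card T} T"
    using ex_bij_betw_nat_finite_1[OF \<open>finite T\<close>] by blast
  have eq: "(\<Sum>i=1..card T. u (z i)) = (\<Sum>y\<in>T. u y)"
    "(\<Sum>i=1..card T. u (z i) *\<^sub>R z i) = (\<Sum>y\<in>T. u y *\<^sub>R y)"
    "(\<Sum>i=1..card T. u (z i) * f (z i)) = (\<Sum>y\<in>T. u y * f y)"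
    by (rule sum.reindex_bij_betw[OF z])+
  have "\<forall>i\<in>{1..card T}. z i \<in> D \<and> 0 \<le> u (z i)"
    using z nonneg \<open>T \<subseteq> D\<close> by (auto simp: bij_betw_def)
  then show ?thesis
    using \<open>concave_on_set D f\<close>[unfolded concave_on_set_def, rule_format, of "card T" z "u \<circ> z"]
      sum mem eq by simp
qed

text \<open>If all values on \<open>T\<close> were positive, so would be their weighted mean, some
  weight being positive; concavity bounds that mean by \<open>f x \<le> 0\<close>.\<close>

lemma exists_nonpos_of_concave:
  assumes "concave_on_set D f" "finite T" "T \<subseteq> D"
    and x: "x \<in> convex hull T" "x \<in> D" "f x \<le> 0"
  shows "\<exists>y\<in>T. f y \<le> 0"
proof (rule ccontr)
  assume "\<not> (\<exists>y\<in>T. f y \<le> 0)"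
  then have pos: "0 < f y" if "y \<in> T" for y
    using that by force
  obtain u where u: "\<forall>y\<in>T. 0 \<le> u y" "sum u T = 1" and eq: "(\<Sum>y\<in>T. u y *\<^sub>R y) = x"
    using x(1) by (auto simp: convex_hull_finite[OF \<open>finite T\<close>])
  obtain y where y: "y \<in> T" "0 < u y"
    using u by (metis less_le sum.neutral zero_neq_one)
  then have "0 < (\<Sum>y\<in>T. u y * f y)"
    using u pos \<open>finite T\<close> by (intro sum_pos2[of _ y]) (auto simp: less_imp_le)
  moreover have "(\<Sum>y\<in>T. u y * f y) \<le> f x"
    using concave_on_setD[OF assms(1-3), of u] u x(2) eq by simp
  ultimately show False
    using x(3) by simp
qed

section \<open>Consequences of lower semicontinuity\<close>

lemma closed_lower_level_set:
  assumes "closed K" "lower_semicontinuous_on K K f"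
  shows "closed {x\<in>K. f x \<le> c}"
proof -
  have "x \<in> {x\<in>K. f x \<le> c}" if "x islimpt {x\<in>K. f x \<le> c}" for x
  proof -
    have "x \<in> K"
      using that \<open>closed K\<close> islimpt_subset[of x _ K] by (auto simp: closed_limpt)
    moreover have "f x \<le> c"
    proof (rule ccontr)
      assume "\<not> f x \<le> c"
      then have "\<forall>\<^sub>F z in at x within K. c < f z"
        using assms(2) \<open>x \<in> K\<close>
        by (auto simp: lower_semicontinuous_on_def lower_semicontinuous_at_within_def)
      then obtain U where "open U" "x \<in> U" "\<And>z. z \<in> U \<Longrightarrow> z \<noteq> x \<Longrightarrow> z \<in> K \<Longrightarrow> c < f z"
        unfolding eventually_at_topological by blast
      moreover obtain z where "z \<in> K" "f z \<le> c" "z \<in> U" "z \<noteq> x"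
        using \<open>x islimpt _\<close> \<open>x \<in> U\<close> \<open>open U\<close> by (auto elim: islimptE)
      ultimately show False
        by force
    qed
    ultimately show ?thesis
      by simp
  qed
  then show ?thesis
    unfolding closed_limpt by blast
qed

text \<open>Lying outside \<open>D\<close> makes \<open>y\<close> a limit point of \<open>D\<close>.
  Since neighbourhoods are relative to \<open>K\<close>, a value above \<open>c\<close> at
  \<open>y\<close> would force such values at points of \<open>D\<close>.\<close>

lemma nonpos_of_dense_nonpos:
  assumes "D \<subseteq> K" "y \<in> closure D" "y \<notin> D"
    and "lower_semicontinuous_at_within K f y" "\<And>z. z \<in> D \<Longrightarrow> f z \<le> c"
  shows "f y \<le> c"
proof (rule ccontr)
  assume "\<not> f y \<le> c"
  then have "\<forall>\<^sub>F z in at y within K. c < f z"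
    using assms(4) by (auto simp: lower_semicontinuous_at_within_def)
  then obtain U where "open U" "y \<in> U" "\<And>z. z \<in> U \<Longrightarrow> z \<noteq> y \<Longrightarrow> z \<in> K \<Longrightarrow> c < f z"
    unfolding eventually_at_topological by blast
  moreover have "y islimpt D"
    using assms(2,3) by (simp add: closure_def)
  then obtain z where "z \<in> D" "z \<in> U" "z \<noteq> y"
    using \<open>y \<in> U\<close> \<open>open U\<close> by (rule islimptE)
  ultimately have "c < f z"
    using \<open>D \<subseteq> K\<close> by blast
  then show False
    using assms(5)[OF \<open>z \<in> D\<close>] by simp
qed

section \<open>The KKM theorem applied to the lower level sets\<close>

theorem theorem3p5:
  fixes K D :: "'a::{locally_convex_space, t2_space} set"
    and \<phi> :: "'a \<Rightarrow> 'a \<Rightarrow> real"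
  assumes "K \<noteq> {}" and "convex K" and "compact K"
    and "D \<subseteq> K" and "self_segment_dense D K"
    and "\<And>y. y \<in> D \<Longrightarrow> lower_semicontinuous_on K K (\<lambda>x. \<phi> x y)"
    and "\<And>x. x \<in> K \<Longrightarrow> lower_semicontinuous_on K (K - D) (\<lambda>y. \<phi> x y)"
    and "\<And>x. x \<in> D \<Longrightarrow> concave_on_set D (\<lambda>y. \<phi> x y)"
    and "\<And>x. x \<in> D \<Longrightarrow> \<phi> x x \<le> 0"
  shows "\<exists>x\<^sub>0\<in>K. \<forall>y\<in>K. \<phi> x\<^sub>0 y \<le> 0"
proof -
  define G where "G y = {x\<in>K. \<phi> x y \<le> 0}" for y
  have "closed K"
    using \<open>compact K\<close> by (rule compact_imp_closed)
  have closed_G: "closed (G y)" if "y \<in> D" for y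
    unfolding G_def by (rule closed_lower_level_set[OF \<open>closed K\<close> assms(6)[OF that]])
  have cover: "convex hull T \<subseteq> (\<Union>y\<in>T. G y)" if "finite T" "T \<subseteq> D" for T
  proof -
    have "\<exists>y\<in>T. x \<in> G y" if "x \<in> convex hull T \<inter> D" for x
      using exists_nonpos_of_concave[OF assms(8) \<open>finite T\<close> \<open>T \<subseteq> D\<close>, of x x] that assms(4,9)
      by (auto simp: G_def)
    then have "closure (convex hull T \<inter> D) \<subseteq> (\<Union>y\<in>T. G y)"
      using that closed_G by (intro closure_minimal closed_UN) auto
    then show ?thesis
      using self_segment_dense_convex_hull[OF assms(5) that] by blast
  qed
  have "K \<inter> (\<Inter>y\<in>D. G y) \<noteq> {}"
  proof (rule compact_imp_fip_image[OF \<open>compact K\<close> closed_G])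
    fix T assume T: "finite T" "T \<subseteq> D"
    show "K \<inter> (\<Inter>y\<in>T. G y) \<noteq> {}"
    \<comment> \<open>For nonempty \<open>T\<close> the intersection already lies in
      \<open>K\<close>; the empty subfamily is where \<open>K \<noteq> {}\<close> enters.\<close>
    proof (cases "T = {}")
      case False
      have "(\<Inter>y\<in>T. G y) \<noteq> {}"
        using T closed_G by (intro kkm cover) (auto intro: finite_subset)
      then show ?thesis
        using False by (auto simp: G_def)
    qed (use \<open>K \<noteq> {}\<close> in simp)
  qed
  then obtain x where "x \<in> K" and x: "\<And>y. y \<in> D \<Longrightarrow> \<phi> x y \<le> 0"
    by (auto simp: G_def)
  have "\<phi> x y \<le> 0" if "y \<in> K" for y
  proof (cases "y \<in> D")
    case False
    show ?thesis
    proof (rule nonpos_of_dense_nonpos[OF \<open>D \<subseteq> K\<close> _ False _ x])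
      show "y \<in> closure D"
        using assms(5) that by (auto simp: self_segment_dense_def)
      show "lower_semicontinuous_at_within K (\<phi> x) y"
        using assms(7)[OF \<open>x \<in> K\<close>] that False by (simp add: lower_semicontinuous_on_def)
    qed
  qed (rule x)
  then show ?thesis
    using \<open>x \<in> K\<close> by blast
qed

end
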